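(* Let $m\ge 3$ and $n\ge r+1\ge 3$ be integers. If ($3\le m\le 4$ and $2\le r\le 3$), or if $(m-1)(r-1)<\binom{r+1}{2}$, then $\chi_{lat}(A(mK_n,K_r))=n$.
   Context: Graphs are finite and simple. For $m\ge 2$ and $n>r\ge 1$, $A(mK_n,K_r)$ is the amalgamation of $m$ copies of $K_n$ along $K_r$: it has vertices $v_{i,j}$ ($1\le i\le m$, $1\le j\le n$) where $v_{1,j}=\cdots=v_{m,j}$ for each $1\le j\le r$ (and no other identifications), and edges $v_{i,j}v_{i,k}$ for $1\le i\le m$, $1\le j<k\le n$. For a graph $G$ of order $p$ and size $q$, a local antimagic total labeling of $G$ is a bijection $f:V(G)\cup E(G)\to\{1,\ldots,p+q\}$ such that $w_f(u)\neq w_f(v)$ for every edge $uv$ of $G$, where $w_f(u)=f(u)+\sum_{ux\in E(G)}f(ux)$. $\chi_{lat}(G)$ is the minimum number of distinct values of $w_f$ over all local antimagic total labelings $f$ of $G$. *)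

theory Defs
  imports Complex_Main
begin

text \<open>A graph is given by its vertex set and its set of edges, an edge being the
  two-element set of its ends.\<close>

definition simple_graph :: "'a set \<Rightarrow> 'a set set \<Rightarrow> bool" where
  "simple_graph V E \<longleftrightarrow> finite V \<and> (\<forall>e\<in>E. \<exists>u\<in>V. \<exists>v\<in>V. u \<noteq> v \<and> e = {u, v})"

text \<open>A total labeling is a function on the disjoint sum of vertices (\<open>Inl\<close>) and
  edges (\<open>Inr\<close>).\<close>

definition weight :: "'a set \<Rightarrow> 'a set set \<Rightarrow> ('a + 'a set \<Rightarrow> nat) \<Rightarrow> 'a \<Rightarrow> nat" where
  "weight V E f u = f (Inl u) + (\<Sum>x \<in> {x \<in> V. {u, x} \<in> E}. f (Inr {u, x}))"

definition local_antimagic_total_labeling ::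
  "'a set \<Rightarrow> 'a set set \<Rightarrow> ('a + 'a set \<Rightarrow> nat) \<Rightarrow> bool" where
  "local_antimagic_total_labeling V E f \<longleftrightarrow>
     bij_betw f (V <+> E) {1..card V + card E} \<and>
     (\<forall>u v. {u, v} \<in> E \<longrightarrow> weight V E f u \<noteq> weight V E f v)"

text \<open>On \<^typ>\<open>nat\<close>, \<^const>\<open>Inf\<close> is the minimum of a nonempty set and 0 for the empty
  set, so a positive value includes the existence of a labeling.\<close>

definition chi_lat :: "'a set \<Rightarrow> 'a set set \<Rightarrow> nat" where
  "chi_lat V E = Inf {card (weight V E f ` V) | f. local_antimagic_total_labeling V E f}"

text \<open>The vertex \<open>v\<^bsub>i,j\<^esub>\<close> of the amalgamation along \<open>K\<^sub>r\<close>: for \<open>j \<le> r\<close> the index of the copy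
  is forgotten by replacing it with 1, which makes \<open>v\<^bsub>1,j\<^esub>, \<dots>, v\<^bsub>m,j\<^esub>\<close> the same vertex.\<close>

definition amalg_vertex :: "nat \<Rightarrow> nat \<Rightarrow> nat \<Rightarrow> nat \<times> nat" where
  "amalg_vertex r i j = (if j \<le> r then (1, j) else (i, j))"

definition amalg_verts :: "nat \<Rightarrow> nat \<Rightarrow> nat \<Rightarrow> (nat \<times> nat) set" where
  "amalg_verts m n r = {amalg_vertex r i j | i j. 1 \<le> i \<and> i \<le> m \<and> 1 \<le> j \<and> j \<le> n}"

definition amalg_edges :: "nat \<Rightarrow> nat \<Rightarrow> nat \<Rightarrow> (nat \<times> nat) set set" where
  "amalg_edges m n r =
     {{amalg_vertex r i j, amalg_vertex r i k} | i j k. 1 \<le> i \<and> i \<le> m \<and> 1 \<le> j \<and> j < k \<and> k \<le> n}"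

lemma amalg_vertex_eq_iff:
  "amalg_vertex r i j = amalg_vertex r i' j' \<longleftrightarrow> j = j' \<and> (j \<le> r \<or> i = i')"
  by (auto simp: amalg_vertex_def)

lemma simple_graph_amalg: "simple_graph (amalg_verts m n r) (amalg_edges m n r)"
proof -
  have "amalg_verts m n r = (\<lambda>(i, j). amalg_vertex r i j) ` ({1..m} \<times> {1..n})"
    by (auto simp: amalg_verts_def image_iff) (metis atLeastAtMost_iff SigmaI case_prod_conv One_nat_def)+
  then have fin: "finite (amalg_verts m n r)"
    by simp
  have "\<exists>u\<in>amalg_verts m n r. \<exists>v\<in>amalg_verts m n r. u \<noteq> v \<and> e = {u, v}"
    if "e \<in> amalg_edges m n r" for e
  proof -
    from that obtain i j k where *: "1 \<le> i" "i \<le> m" "1 \<le> j" "j < k" "k \<le> n"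
      and e: "e = {amalg_vertex r i j, amalg_vertex r i k}"
      unfolding amalg_edges_def by blast
    have "amalg_vertex r i l \<in> amalg_verts m n r" if "1 \<le> l" "l \<le> n" for l
      unfolding amalg_verts_def using *(1,2) that by blast
    then have "amalg_vertex r i j \<in> amalg_verts m n r" "amalg_vertex r i k \<in> amalg_verts m n r"
      using *(3-5) by simp_all
    moreover have "amalg_vertex r i j \<noteq> amalg_vertex r i k"
      using * by (simp add: amalg_vertex_eq_iff)
    ultimately show ?thesis
      using e by blast
  qed
  with fin show ?thesis
    by (simp add: simple_graph_def)
qed

end

theory Submission
  imports Defs "HOL-Library.Nat_Bijection" "HOL-Library.Infinite_Set"
begin

text \<open>Each copy of \<open>K\<^sub>n\<close> is a clique, so its weights are pairwise distinct and at least \<open>n\<close> values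
  occur (\<open>le_card_weights\<close>). It remains to find one labeling in which all vertices \<open>v\<^bsub>i,j\<^esub>\<close> with the
  same \<open>j\<close> get the same weight and different \<open>j\<close> give different weights.

  Call the vertices with \<open>j \<le> r\<close> core and the others outer, and put \<open>s = n - r\<close>. Copy \<open>i\<close> is a symmetric
  \<open>n \<times> n\<close> matrix, with vertex labels on the diagonal and edge labels elsewhere; the copies share the core
  block. A position outside the core block receives \<open>m\<close> labels, one for each copy, namely the terms of
  an arithmetic progression, which the copies run through either upwards or downwards. An outer
  row sum is then an affine function of \<open>i\<close>, with slope the signed sum of the progression steps of the row.

  If \<open>n\<close> is even, all steps are 1, the progressions are consecutive blocks of \<open>m\<close> integers, and the
  checkerboard of directions \<open>(- 1) ^ (j + k)\<close> has all slopes 0. If \<open>n\<close> is odd, a row has an odd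
  number of entries and steps 1 cannot cancel. There column 1 uses step 2: two consecutive outer
  rows share an interval of \<open>2 m\<close> integers, one taking every second number and the other
  the rest. Reversing the directions in columns 1 and 2 (both in the core, as \<open>r \<ge> 2\<close>) makes the slopes
  vanish again, because \<open>2 - 1 + (- 1 + 1 - \<dots> - 1) = 0\<close> (\<open>sum_step_sign\<close>, \<open>outer_row_sum\<close>). If \<open>s\<close> is
  odd, the last outer row has no partner; the \<open>m - 1\<close> gaps in its progression are filled with
  core labels. This is possible because the core has \<open>(r + 1) choose 2\<close> labels, which under either
  alternative of the hypothesis is at least \<open>m - 1\<close>.

  For distinct weights the progressions are ordered suitably: the smallest labels go to positions with both
  indices outer, enumerated along a triangle, then come the core columns \<open>r, \<dots>, 2, 1\<close>, and finally
  the core block, filled in decreasing order. Comparing position by position, outer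
  weights increase in \<open>j\<close> (\<open>outer_row_strict_mono\<close>) and core weights decrease in \<open>j\<close>. A core vertex
  outweighs every outer one since it meets \<open>m s\<close> outer vertices and core labels are large.\<close>

section \<open>Vertices and edges as matrix cells\<close>

text \<open>The cell \<open>(i, j, k)\<close> is the position in row \<open>j\<close> and column \<open>k \<le> j\<close> of the matrix of copy \<open>i\<close>. In the
  core block the copies coincide, which is why only \<open>i = 1\<close> occurs there; a position lies in
  that block exactly if its larger index \<open>j\<close> is at most \<open>r\<close>.\<close>

definition cells :: "nat \<Rightarrow> nat \<Rightarrow> nat \<Rightarrow> (nat \<times> nat \<times> nat) set" where
  "cells m n r = {(i, j, k). 1 \<le> i \<and> i \<le> m \<and> 1 \<le> k \<and> k \<le> j \<and> j \<le> n \<and> (j \<le> r \<longrightarrow> i = 1)}"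

definition cell_element :: "nat \<Rightarrow> nat \<times> nat \<times> nat \<Rightarrow> (nat \<times> nat) + (nat \<times> nat) set" where
  "cell_element r = (\<lambda>(i, j, k). if j = k then Inl (i, j) else Inr {(i, j), amalg_vertex r i k})"

lemma finite_amalg_verts: "finite (amalg_verts m n r)"
  using simple_graph_amalg[of m n r] by (simp add: simple_graph_def)

lemma mem_amalg_verts_iff:
  assumes "1 \<le> m"
  shows "(i, j) \<in> amalg_verts m n r \<longleftrightarrow> 1 \<le> i \<and> i \<le> m \<and> 1 \<le> j \<and> j \<le> n \<and> (j \<le> r \<longrightarrow> i = 1)"
proof
  assume "(i, j) \<in> amalg_verts m n r"
  with assms show "1 \<le> i \<and> i \<le> m \<and> 1 \<le> j \<and> j \<le> n \<and> (j \<le> r \<longrightarrow> i = 1)"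
    by (auto simp: amalg_verts_def amalg_vertex_def split: if_splits)
next
  assume *: "1 \<le> i \<and> i \<le> m \<and> 1 \<le> j \<and> j \<le> n \<and> (j \<le> r \<longrightarrow> i = 1)"
  then have "(i, j) = amalg_vertex r i j" by (simp add: amalg_vertex_def)
  with * show "(i, j) \<in> amalg_verts m n r" unfolding amalg_verts_def by blast
qed

text \<open>Naming the end of larger index first makes the description of an edge unique, up to the copy
  index of a core edge, which is normalised to 1.\<close>

lemma amalg_edge_cases:
  assumes "e \<in> amalg_edges m n r"
  obtains i j k where "(i, j, k) \<in> cells m n r" "k < j" "e = {(i, j), amalg_vertex r i k}"
proof -
  from assms obtain i k j where *: "1 \<le> i" "i \<le> m" "1 \<le> k" "k < j" "j \<le> n"
      and e: "e = {amalg_vertex r i k, amalg_vertex r i j}"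
    unfolding amalg_edges_def by blast
  show thesis
  proof (rule that)
    show "((if j \<le> r then 1 else i), j, k) \<in> cells m n r" using * by (auto simp: cells_def)
    show "e = {((if j \<le> r then 1 else i), j), amalg_vertex r (if j \<le> r then 1 else i) k}"
      using * e by (auto simp: amalg_vertex_def)
  qed (use * in auto)
qed

lemma cell_edge:
  assumes "(i, j, k) \<in> cells m n r" "k < j"
  shows "{(i, j), amalg_vertex r i k} \<in> amalg_edges m n r"
proof -
  from assms have "(i, j) = amalg_vertex r i j" and *: "1 \<le> i" "i \<le> m" "1 \<le> k" "k < j" "j \<le> n"
    by (auto simp: cells_def amalg_vertex_def)
  then have "{(i, j), amalg_vertex r i k} = {amalg_vertex r i k, amalg_vertex r i j}" by auto
  with * show ?thesis unfolding amalg_edges_def by blast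
qed

lemma bij_betw_cell_element:
  assumes "1 \<le> m"
  shows "bij_betw (cell_element r) (cells m n r) (amalg_verts m n r <+> amalg_edges m n r)"
  unfolding bij_betw_def
proof
  show "inj_on (cell_element r) (cells m n r)"
    by (rule inj_onI)
      (auto simp: cells_def cell_element_def amalg_vertex_def doubleton_eq_iff split: if_splits)
  show "cell_element r ` cells m n r = amalg_verts m n r <+> amalg_edges m n r" (is "?L = ?R")
  proof
    show "?L \<subseteq> ?R"
    proof
      fix y assume "y \<in> ?L"
      then obtain i j k where c: "(i, j, k) \<in> cells m n r" and y: "y = cell_element r (i, j, k)"
        by auto
      show "y \<in> ?R"
      proof (cases "j = k")
        case True
        with c y assms show ?thesis by (auto simp: cells_def cell_element_def mem_amalg_verts_iff)
      next
        case False
        with c have "k < j" by (auto simp: cells_def)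
        from cell_edge[OF c this] False y show ?thesis by (auto simp: cell_element_def)
      qed
    qed
    show "?R \<subseteq> ?L"
    proof
      fix y assume "y \<in> ?R"
      then consider (v) i j where "(i, j) \<in> amalg_verts m n r" "y = Inl (i, j)"
        | (e) e where "e \<in> amalg_edges m n r" "y = Inr e" by auto
      then show "y \<in> ?L"
      proof cases
        case v
        then have "(i, j, j) \<in> cells m n r" using assms by (auto simp: cells_def mem_amalg_verts_iff)
        then show ?thesis using v by (force simp: cell_element_def)
      next
        case e
        from e(1) obtain i j k where "(i, j, k) \<in> cells m n r" "k < j" "e = {(i, j), amalg_vertex r i k}"
          by (rule amalg_edge_cases)
        then show ?thesis using e by (force simp: cell_element_def)
      qed
    qed
  qed
qed

lemma amalg_edge_imp:
  assumes "1 \<le> m" "{u, v} \<in> amalg_edges m n r"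
  shows "u \<in> amalg_verts m n r" "v \<in> amalg_verts m n r" "snd u \<noteq> snd v"
proof -
  from assms(2) obtain i j k where c: "(i, j, k) \<in> cells m n r" "k < j"
    and e: "{u, v} = {(i, j), amalg_vertex r i k}" by (rule amalg_edge_cases)
  have "(i, j) \<in> amalg_verts m n r" "amalg_vertex r i k \<in> amalg_verts m n r"
    using c assms(1) by (auto simp: mem_amalg_verts_iff cells_def amalg_vertex_def)
  with e c show "u \<in> amalg_verts m n r" "v \<in> amalg_verts m n r" "snd u \<noteq> snd v"
    by (auto simp: doubleton_eq_iff amalg_vertex_def split: if_splits)
qed

lemma neighbours_outer:
  assumes "1 \<le> i" "i \<le> m" "r < j" "j \<le> n"
  shows "{x \<in> amalg_verts m n r. {(i, j), x} \<in> amalg_edges m n r} = amalg_vertex r i ` ({1..n} - {j})"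
    (is "?L = ?R")
proof
  show "?L \<subseteq> ?R"
  proof
    fix x assume x: "x \<in> ?L"
    then have "{(i, j), x} \<in> amalg_edges m n r" by simp
    then obtain i' j' k where c: "(i', j', k) \<in> cells m n r" "k < j'"
      and e: "{(i, j), x} = {(i', j'), amalg_vertex r i' k}" by (rule amalg_edge_cases)
    from e consider "i = i'" "j = j'" "x = amalg_vertex r i' k"
      | "(i, j) = amalg_vertex r i' k" "x = (i', j')" by (auto simp: doubleton_eq_iff)
    then show "x \<in> ?R"
    proof cases
      case 1 with c assms show ?thesis by (auto simp: cells_def)
    next
      case 2 
      then have "i' = i" "k = j" using assms by (auto simp: amalg_vertex_def split: if_splits)
      with 2 c assms have "x = amalg_vertex r i j'" "j' \<in> {1..n} - {j}"
        by (auto simp: cells_def amalg_vertex_def)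
      then show ?thesis by blast
    qed
  qed
  show "?R \<subseteq> ?L"
  proof
    fix x assume "x \<in> ?R"
    then obtain k where "k \<in> {1..n} - {j}" and x: "x = amalg_vertex r i k" ..
    then have k: "k \<in> {1..n}" "k \<noteq> j" by simp_all
    have "{(i, j), x} \<in> amalg_edges m n r"
    proof (cases "k < j")
      case True
      with assms k x show ?thesis by (auto intro!: cell_edge simp: cells_def)
    next
      case False
      then have "{(i, k), amalg_vertex r i j} \<in> amalg_edges m n r"
        using assms k by (intro cell_edge) (auto simp: cells_def)
      then show ?thesis using False assms k x by (simp add: amalg_vertex_def insert_commute)
    qed
    then show "x \<in> ?L" using amalg_edge_imp[of m "(i, j)" x n r] assms by auto
  qed
qed

lemma neighbours_core:
  assumes "1 \<le> m" "1 \<le> c" "c \<le> r" "r \<le> n"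
  shows "{x \<in> amalg_verts m n r. {(1, c), x} \<in> amalg_edges m n r}
    = Pair 1 ` ({1..r} - {c}) \<union> {1..m} \<times> {r<..n}"
    (is "?L = ?R")
proof
  show "?L \<subseteq> ?R"
  proof
    fix x assume x: "x \<in> ?L"
    obtain i j where [simp]: "x = (i, j)" by force
    from x amalg_edge_imp[of m "(1, c)" x n r] assms show "x \<in> ?R"
      by (auto simp: mem_amalg_verts_iff)
  qed
  show "?R \<subseteq> ?L"
  proof
    fix x assume x: "x \<in> ?R"
    obtain i k where [simp]: "x = (i, k)" by force
    have "{(1, c), x} \<in> amalg_edges m n r"
    proof (cases "k < c")
      case True
      then have "{(1, c), amalg_vertex r 1 k} \<in> amalg_edges m n r"
        using assms x by (intro cell_edge) (auto simp: cells_def)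
      then show ?thesis using x True assms by (auto simp: amalg_vertex_def)
    next
      case False
      then have "{(i, k), amalg_vertex r i c} \<in> amalg_edges m n r"
        using assms x by (intro cell_edge) (auto simp: cells_def)
      then show ?thesis using x False assms by (auto simp: amalg_vertex_def insert_commute)
    qed
    then show "x \<in> ?L" using amalg_edge_imp[of m "(1, c)" x n r] assms by auto
  qed
qed

section \<open>Reduction to a labeling of the cells\<close>

text \<open>The first copy is a clique, so it shows \<open>n\<close> different weights.\<close>

lemma le_card_weights:
  assumes "1 \<le> m" and f: "local_antimagic_total_labeling (amalg_verts m n r) (amalg_edges m n r) f"
  shows "n \<le> card (weight (amalg_verts m n r) (amalg_edges m n r) f ` amalg_verts m n r)"
    (is "n \<le> card (?w ` ?V)")
proof -
  have edge: "{(1, j), (1, k)} \<in> amalg_edges m n r" if "1 \<le> k" "k < j" "j \<le> n" for j k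
  proof -
    have "{(1, j), amalg_vertex r 1 k} \<in> amalg_edges m n r"
      using that assms by (intro cell_edge) (auto simp: cells_def)
    then show ?thesis by (simp add: amalg_vertex_def split: if_splits)
  qed
  have neq: "?w (1, j) \<noteq> ?w (1, k)" if "1 \<le> k" "k < j" "j \<le> n" for j k
    using edge[OF that] f by (auto simp: local_antimagic_total_labeling_def)
  have "inj_on (\<lambda>j. ?w (1, j)) {1..n}"
  proof (rule inj_onI)
    fix j k assume "j \<in> {1..n}" "k \<in> {1..n}" "?w (1, j) = ?w (1, k)"
    then show "j = k" using neq[of j k] neq[of k j] by (cases j k rule: linorder_cases) auto
  qed
  then have "n = card ((\<lambda>j. ?w (1, j)) ` {1..n})" by (simp add: card_image)
  also have "\<dots> \<le> card (?w ` ?V)"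
    using assms by (intro card_mono) (auto simp: finite_amalg_verts mem_amalg_verts_iff)
  finally show ?thesis .
qed

text \<open>The labels of copy \<open>i\<close> enter as a symmetric matrix \<open>lab i\<close>. The weight of an outer vertex is then a row
  sum of its own copy, whereas a core vertex collects one row of the core block and its column in
  every copy. If these sums depend only on the index through an injective \<open>W\<close>, the number of weights
  is \<open>n\<close> and the labeling is automatically local antimagic, because adjacent vertices have different
  indices.\<close>

lemma chi_lat_amalg_eqI:
  fixes lab :: "nat \<Rightarrow> nat \<Rightarrow> nat \<Rightarrow> nat" and W :: "nat \<Rightarrow> nat"
  assumes "1 \<le> m" "r \<le> n"
    and sym: "\<And>i j k. lab i j k = lab i k j"
    and bij: "bij_betw (\<lambda>(i, j, k). lab i j k) (cells m n r) {1..card (cells m n r)}"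
    and outer: "\<And>i j. \<lbrakk>1 \<le> i; i \<le> m; r < j; j \<le> n\<rbrakk> \<Longrightarrow>
      (\<Sum>k=1..r. lab i j k) + (\<Sum>k\<in>{r<..n}. lab i j k) = W j"
    and core: "\<And>c. \<lbrakk>1 \<le> c; c \<le> r\<rbrakk> \<Longrightarrow>
      (\<Sum>k=1..r. lab 1 c k) + (\<Sum>k\<in>{r<..n}. \<Sum>i=1..m. lab i k c) = W c"
    and W: "inj_on W {1..n}"
  shows "chi_lat (amalg_verts m n r) (amalg_edges m n r) = n"
proof -
  let ?V = "amalg_verts m n r" and ?E = "amalg_edges m n r"
  let ?I = "cells m n r" and ?\<phi> = "cell_element r"
  define f where "f = (\<lambda>(i, j, k). lab i j k) \<circ> inv_into ?I ?\<phi>"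
  note bij\<phi> = bij_betw_cell_element[OF assms(1), of r n]
  have f_cell: "f (?\<phi> (i, j, k)) = lab i j k" if "(i, j, k) \<in> ?I" for i j k
    using that bij\<phi> by (simp add: f_def bij_betw_inv_into_left)
  have "finite ?E"
  proof -
    have "?E \<subseteq> Pow ?V"
    proof
      fix e assume "e \<in> ?E"
      then obtain u v where "u \<in> ?V" "v \<in> ?V" "e = {u, v}"
        using simple_graph_amalg[of m n r] unfolding simple_graph_def by blast
      then show "e \<in> Pow ?V" by simp
    qed
    then show ?thesis using finite_amalg_verts finite_subset by blast
  qed
  then have card: "card ?I = card ?V + card ?E"
    using bij_betw_same_card[OF bij\<phi>] by (simp add: card_Plus finite_amalg_verts)
  have bij_f: "bij_betw f (?V <+> ?E) {1..card ?V + card ?E}"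
    unfolding f_def by (rule bij_betw_trans[OF bij_betw_inv_into[OF bij\<phi>]]) (use bij card in simp)
  have f_vert: "f (Inl (i, j)) = lab i j j" if "(i, j) \<in> ?V" for i j
    using f_cell[of i j j] that assms(1) by (auto simp: cells_def cell_element_def mem_amalg_verts_iff)
  have f_edge: "f (Inr {(i, j), amalg_vertex r i k}) = lab i j k"
    if "1 \<le> i" "i \<le> m" "r < j" "1 \<le> k" "j \<le> n" "k \<le> n" "k \<noteq> j" for i j k
  proof (cases "k < j")
    case True
    then show ?thesis using f_cell[of i j k] that by (auto simp: cells_def cell_element_def)
  next
    case False
    then have "{(i, j), amalg_vertex r i k} = {(i, k), amalg_vertex r i j}"
      using that by (auto simp: amalg_vertex_def)
    then show ?thesis using f_cell[of i k j] that False sym by (auto simp: cells_def cell_element_def)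
  qed
  have f_core: "f (Inr {(1, c), (1, k)}) = lab 1 c k"
    if "1 \<le> c" "c \<le> r" "1 \<le> k" "k \<le> r" "k \<noteq> c" for c k
  proof (cases "k < c")
    case True
    then show ?thesis using f_cell[of 1 c k] that assms
      by (auto simp: cells_def cell_element_def amalg_vertex_def)
  next
    case False
    then have "(1, k, c) \<in> ?I" using that assms(1,2) by (simp add: cells_def)
    then have "f (?\<phi> (1, k, c)) = lab 1 k c" by (rule f_cell)
    moreover have "?\<phi> (1, k, c) = Inr {(1, c), (1, k)}"
      using that by (simp add: cell_element_def amalg_vertex_def insert_commute)
    ultimately show ?thesis by (simp only: sym[of 1 k c])
  qed
  have weight_W: "weight ?V ?E f u = W (snd u)" if "u \<in> ?V" for u
  proof -
    obtain i j where u: "u = (i, j)" by force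
    with that assms have ij: "1 \<le> i" "i \<le> m" "1 \<le> j" "j \<le> n" "j \<le> r \<longrightarrow> i = 1"
      by (auto simp: mem_amalg_verts_iff)
    show ?thesis
    proof (cases "r < j")
      case True
      have "inj_on (amalg_vertex r i) ({1..n} - {j})"
        by (auto simp: inj_on_def amalg_vertex_eq_iff)
      then have "weight ?V ?E f u = lab i j j + (\<Sum>k\<in>{1..n} - {j}. f (Inr {(i, j), amalg_vertex r i k}))"
        using ij True that u
        by (simp add: weight_def f_vert neighbours_outer sum.reindex)
      also have "(\<Sum>k\<in>{1..n} - {j}. f (Inr {(i, j), amalg_vertex r i k})) = (\<Sum>k\<in>{1..n} - {j}. lab i j k)"
        using ij True by (intro sum.cong) (auto intro: f_edge)
      also have "lab i j j + \<dots> = (\<Sum>k\<in>{1..n}. lab i j k)"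
        using ij by (subst sum.remove[of _ j]) auto
      also have "{1..n} = {1..r} \<union> {r<..n}" using assms by auto
      also have "(\<Sum>k\<in>\<dots>. lab i j k) = (\<Sum>k=1..r. lab i j k) + (\<Sum>k\<in>{r<..n}. lab i j k)"
        by (rule sum.union_disjoint) auto
      finally show ?thesis using outer ij True u by simp
    next
      case False
      then have [simp]: "i = 1" and j: "j \<le> r" using ij by auto
      have "weight ?V ?E f u = lab 1 j j +
          (\<Sum>x\<in>Pair 1 ` ({1..r} - {j}) \<union> {1..m} \<times> {r<..n}. f (Inr {(1, j), x}))"
        using that u neighbours_core[of m j r n] ij j assms by (simp add: weight_def f_vert)
      also have "(\<Sum>x\<in>Pair 1 ` ({1..r} - {j}) \<union> {1..m} \<times> {r<..n}. f (Inr {(1, j), x}))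
        = (\<Sum>x\<in>Pair 1 ` ({1..r} - {j}). f (Inr {(1, j), x})) +
          (\<Sum>x\<in>{1..m} \<times> {r<..n}. f (Inr {(1, j), x}))"
        by (rule sum.union_disjoint) auto
      also have "(\<Sum>x\<in>Pair 1 ` ({1..r} - {j}). f (Inr {(1, j), x})) = (\<Sum>k\<in>{1..r} - {j}. lab 1 j k)"
        by (subst sum.reindex) (auto intro!: sum.cong inj_onI f_core simp: ij j simp del: One_nat_def)
      also have "(\<Sum>x\<in>{1..m} \<times> {r<..n}. f (Inr {(1, j), x}))
          = (\<Sum>(i, k)\<in>{1..m} \<times> {r<..n}. lab i k j)"
      proof (intro sum.cong refl)
        fix x assume x: "x \<in> {1..m} \<times> {r<..n}"
        obtain i' k where [simp]: "x = (i', k)" by force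
        have "{(1, j), x} = {(i', k), amalg_vertex r i' j}" using j by (auto simp: amalg_vertex_def)
        then show "f (Inr {(1, j), x}) = (case x of (i, k) \<Rightarrow> lab i k j)"
          using f_edge[of i' k j] x ij j assms by auto
      qed
      also have "\<dots> = (\<Sum>k\<in>{r<..n}. \<Sum>i=1..m. lab i k j)"
        by (subst sum.swap) (simp add: sum.cartesian_product)
      finally have "weight ?V ?E f u = (lab 1 j j + (\<Sum>k\<in>{1..r} - {j}. lab 1 j k))
          + (\<Sum>k\<in>{r<..n}. \<Sum>i=1..m. lab i k j)" by simp
      also have "lab 1 j j + (\<Sum>k\<in>{1..r} - {j}. lab 1 j k) = (\<Sum>k=1..r. lab 1 j k)"
        using ij j by (subst sum.remove[of _ j]) auto
      finally show ?thesis using core[of j] ij j u by simp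
    qed
  qed
  have "weight ?V ?E f u \<noteq> weight ?V ?E f v" if "{u, v} \<in> ?E" for u v
  proof -
    note uv = amalg_edge_imp[OF assms(1) that]
    then have "snd u \<in> {1..n}" "snd v \<in> {1..n}"
      using mem_amalg_verts_iff[OF assms(1), of "fst u" "snd u"]
        mem_amalg_verts_iff[OF assms(1), of "fst v" "snd v"] by auto
    then show ?thesis using uv W by (simp add: weight_W inj_on_eq_iff)
  qed
  with bij_f have lab: "local_antimagic_total_labeling ?V ?E f"
    by (simp add: local_antimagic_total_labeling_def)
  have "weight ?V ?E f ` ?V \<subseteq> W ` {1..n}"
  proof
    fix y assume "y \<in> weight ?V ?E f ` ?V"
    then obtain i j where "(i, j) \<in> ?V" "y = W j" using weight_W by force
    then show "y \<in> W ` {1..n}" using mem_amalg_verts_iff[OF assms(1)] by auto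
  qed
  then have "card (weight ?V ?E f ` ?V) \<le> card (W ` {1..n})" by (intro card_mono) simp_all
  also have "\<dots> = n" using W by (simp add: card_image)
  finally have "card (weight ?V ?E f ` ?V) \<le> n" .
  with le_card_weights[OF assms(1) lab] have "card (weight ?V ?E f ` ?V) = n" by simp
  with lab have "n \<in> {card (weight ?V ?E f ` ?V) | f. local_antimagic_total_labeling ?V ?E f}"
    by (intro CollectI exI[of _ f]) simp
  then show ?thesis
    unfolding chi_lat_def by (rule cInf_eq_minimum) (use le_card_weights[OF assms(1)] in auto)
qed

section \<open>Enumerating a triangle monotonically\<close>

lemma ex_decreasing_bij_betw:
  fixes R :: "nat set"
  assumes "finite R"
  obtains g where "bij_betw g {..<card R} R" "\<And>x y. x < y \<Longrightarrow> y < card R \<Longrightarrow> g y < g x"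
proof -
  obtain h where h: "bij_betw h {..<card R} R" "strict_mono_on {..<card R} h"
    using ex_bij_betw_strict_mono_card[OF assms] .
  let ?rev = "\<lambda>x. card R - 1 - x"
  have "bij_betw ?rev {..<card R} {..<card R}"
    by (rule bij_betw_byWitness[where f' = ?rev]) auto
  then have "bij_betw (h \<circ> ?rev) {..<card R} R"
    using h(1) by (rule bij_betw_trans)
  moreover have "(h \<circ> ?rev) y < (h \<circ> ?rev) x" if "x < y" "y < card R" for x y
    using that by (auto intro: strict_mono_onD[OF h(2)])
  ultimately show thesis by (rule that)
qed

lemma mult_add_inj:
  fixes a b q x y :: nat
  assumes eq: "x * q + a = y * q + b" and "a < q" "b < q"
  shows "x = y \<and> a = b"
proof -
  have "(x * q + a) div q = (y * q + b) div q" "(x * q + a) mod q = (y * q + b) mod q"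
    by (simp_all only: eq)
  with assms(2,3) show ?thesis by simp
qed

lemma mult_add_less:
  fixes a p q x :: nat
  assumes "x < p" "a < q"
  shows "x * q + a < p * q"
proof -
  have "x * q + a < Suc x * q" using assms by simp
  also have "\<dots> \<le> p * q" using assms by (intro mult_le_mono1) simp
  finally show ?thesis .
qed

text \<open>Numbering the lower triangle row by row and reflecting it at the diagonal yields a symmetric matrix
  whose rows and columns increase strictly, although each value occurs at a single unordered
  position.\<close>

definition tri_index :: "nat \<Rightarrow> nat \<Rightarrow> nat" where
  "tri_index a b = triangle (max a b) + min a b"

lemma tri_index_commute: "tri_index a b = tri_index b a"
  by (simp add: tri_index_def max.commute min.commute)

lemma tri_index_strict_mono: "a < a' \<Longrightarrow> tri_index a b < tri_index a' b"
proof (rule lift_Suc_mono_less[where f = "\<lambda>a. tri_index a b"])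
  show "tri_index a b < tri_index (Suc a) b" for a
    by (cases "b \<le> a") (auto simp: tri_index_def max_def min_def not_le le_Suc_eq)
qed

lemma triangle_mono: "a \<le> b \<Longrightarrow> triangle a \<le> triangle b"
  by (rule lift_Suc_mono_le[where f = triangle]) auto

lemma tri_index_less:
  assumes "a < s" "b < s"
  shows "tri_index a b < triangle s"
proof -
  have "tri_index a b < triangle (Suc (max a b))" by (simp add: tri_index_def)
  also have "\<dots> \<le> triangle s" using assms by (intro triangle_mono) simp
  finally show ?thesis .
qed

lemma tri_index_inj:
  assumes "b \<le> a" "b' \<le> a'" "tri_index a b = tri_index a' b'"
  shows "a = a' \<and> b = b'"
proof -
  have *: "tri_index a b < tri_index a' b'" if "b \<le> a" "b' \<le> a'" "a < a'" for a b a' b'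
  proof -
    have "tri_index a b < triangle (Suc a)" using that by (simp add: tri_index_def)
    also have "\<dots> \<le> triangle a'" using that by (intro triangle_mono) simp
    finally show ?thesis using that by (simp add: tri_index_def max_def min_def)
  qed
  have "a = a'" using *[of b a b' a'] *[of b' a' b a] assms by (cases a a' rule: linorder_cases) auto
  with assms show ?thesis by (simp add: tri_index_def max_def min_def split: if_splits)
qed

lemma card_below_diagonal: "card {(a, b). b \<le> a \<and> a < s} = triangle s"
proof -
  have "{(a, b). b \<le> a \<and> a < s} = Sigma {..<s} (\<lambda>a. {..a})" by auto
  also have "card \<dots> = (\<Sum>a<s. Suc a)" by simp
  also have "\<dots> = triangle s" by (induction s) auto
  finally show ?thesis .
qed

lemma bij_betw_tri_index: "bij_betw (\<lambda>(a, b). tri_index a b) {(a, b). b \<le> a \<and> a < s} {..<triangle s}"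
proof -
  let ?A = "{(a, b). b \<le> a \<and> a < s}"
  have inj: "inj_on (\<lambda>(a, b). tri_index a b) ?A"
    by (auto intro!: inj_onI dest: tri_index_inj)
  have "(\<lambda>(a, b). tri_index a b) ` ?A = {..<triangle s}"
    using inj by (intro card_subset_eq) (auto simp: card_image card_below_diagonal intro: tri_index_less)
  with inj show ?thesis by (simp add: bij_betw_def)
qed

lemma sum_rows: "(\<Sum>j\<in>{r<..r + s}. j) = triangle s + r * s"
proof (induction s)
  case (Suc s)
  have "{r<..r + Suc s} = insert (Suc (r + s)) {r<..r + s}" by auto
  with Suc show ?case by simp
qed simp

section \<open>The labels outside the core\<close>

locale amalg_labeling =
  fixes m n r s :: nat
  assumes m: "3 \<le> m" and r: "2 \<le> r" and s: "1 \<le> s" and n: "n = r + s"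
    and m_le: "m - 1 \<le> triangle r"
begin

text \<open>The checkerboard, with columns 1 and 2 reversed for odd \<open>n\<close>. It is symmetric in two outer indices,
  which are both greater than 2.\<close>

definition ascending :: "nat \<Rightarrow> nat \<Rightarrow> bool" where
  "ascending j k \<longleftrightarrow> even (j + k) \<noteq> (odd n \<and> k \<le> 2)"

text \<open>The place, counted from 0, that copy \<open>i\<close> takes in the progression at position \<open>(j, k)\<close>.\<close>

definition level :: "nat \<Rightarrow> nat \<Rightarrow> nat \<Rightarrow> nat" where
  "level i j k = (if ascending j k then i - 1 else m - i)"

text \<open>The rank of a position outside column 1: positions with two outer indices come first, then the core
  columns from right to left. In particular column 1 comes last, which lets its gaps
  be filled by the core labels that follow.\<close>

definition block :: "nat \<Rightarrow> nat \<Rightarrow> nat" where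
  "block j k = (if k \<le> r then triangle s + ((r - k) * s + (j - r - 1))
     else tri_index (j - r - 1) (k - r - 1))"

text \<open>The number of labels outside column 1 and the core block, and thus the offset of column 1.\<close>

definition base :: nat where
  "base = (triangle s + (r - 1) * s) * m"

text \<open>Column 1 relative to its offset, for the outer row with number \<open>a\<close> counted from 0. For odd \<open>n\<close>
  the rows \<open>2 q\<close> and \<open>2 q + 1\<close> take the even and the odd numbers of one interval of length
  \<open>2 m\<close>.\<close>

definition stretch :: "nat \<Rightarrow> nat \<Rightarrow> nat" where
  "stretch a x = (if even n then a * m + x else 2 * (a div 2 * m + x) + a mod 2)"

definition entry :: "nat \<Rightarrow> nat \<Rightarrow> nat \<Rightarrow> nat" where
  "entry j k x = Suc (if k = 1 then base + stretch (j - r - 1) x else block j k * m + x)"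

definition outer_label :: "nat \<Rightarrow> nat \<Rightarrow> nat \<Rightarrow> nat" where
  "outer_label i j k = entry j k (level i j k)"

text \<open>The labels outside the core block are studied on two sets of cells. The cells outside column 1 fill
  an initial segment of the integers; only column 1 can leave gaps for the core.\<close>

definition outer_cells :: "(nat \<times> nat \<times> nat) set" where
  "outer_cells = {1..m} \<times> Sigma {r<..n} (\<lambda>j. {1..j})"

definition inner_cells :: "(nat \<times> nat \<times> nat) set" where
  "inner_cells = {1..m} \<times> Sigma {r<..n} (\<lambda>j. {2..j})"

lemma finite_cells: "finite outer_cells" "finite inner_cells"
  by (simp_all add: outer_cells_def inner_cells_def)

lemma card_outer_cells: "card outer_cells = base + m * s"
proof -
  have "card outer_cells = m * (\<Sum>j\<in>{r<..n}. j)"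
    by (simp add: outer_cells_def card_cartesian_product)
  also have "\<dots> = m * (triangle s + r * s)" by (simp add: n sum_rows)
  also have "r * s = (r - 1) * s + s" using r by (cases r) auto
  also have "m * (triangle s + (q + s)) = (triangle s + q) * m + m * s" for q
    by (simp add: algebra_simps)
  finally show ?thesis by (simp only: base_def)
qed

lemma card_inner_cells: "card inner_cells = base"
proof -
  have "(\<Sum>j\<in>{r<..n}. j) = (\<Sum>j\<in>{r<..n}. (j - 1) + 1)" by (intro sum.cong) auto
  also have "\<dots> = (\<Sum>j\<in>{r<..n}. j - 1) + s" by (simp only: sum.distrib) (simp add: n)
  also have "(\<Sum>j\<in>{r<..n}. j) = triangle s + r * s" by (simp add: n sum_rows)
  also have "r * s = (r - 1) * s + s" using r by (cases r) auto
  finally have "(\<Sum>j\<in>{r<..n}. j - 1) = triangle s + (r - 1) * s" by simp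
  then show ?thesis by (simp add: inner_cells_def card_cartesian_product base_def)
qed

lemma level_less: "1 \<le> i \<Longrightarrow> i \<le> m \<Longrightarrow> level i j k < m"
  by (auto simp: level_def)

lemma bij_betw_level: "bij_betw (\<lambda>i. level i j k) {1..m} {..<m}"
  by (rule bij_betw_byWitness[where f' = "\<lambda>x. if ascending j k then Suc x else m - x"])
    (auto simp: level_def)

lemma block_less:
  assumes "r < j" "j \<le> n" "2 \<le> k" "k \<le> n"
  shows "block j k < triangle s + (r - 1) * s"
proof (cases "k \<le> r")
  case True
  have "(r - k) * s + (j - r - 1) < (r - 1) * s" using assms True n by (intro mult_add_less) auto
  with True show ?thesis by (simp add: block_def)
next
  case False
  with assms have "tri_index (j - r - 1) (k - r - 1) < triangle s" by (intro tri_index_less) (auto simp: n)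
  with False show ?thesis by (simp add: block_def)
qed

lemma block_inj:
  assumes "r < j" "j \<le> n" "2 \<le> k" "k \<le> j" "r < j'" "j' \<le> n" "2 \<le> k'" "k' \<le> j'" "block j k = block j' k'"
  shows "j = j' \<and> k = k'"
proof -
  have less: "tri_index (j - r - 1) (k - r - 1) < triangle s" if "r < j" "j \<le> n" "r < k" "k \<le> j" for j k
    using that by (intro tri_index_less) (auto simp: n)
  consider "k \<le> r" "k' \<le> r" | "k > r" "k' > r" | "k \<le> r" "k' > r" | "k > r" "k' \<le> r" by linarith
  then show ?thesis
  proof cases
    case 1
    have "(r - k) * s + (j - r - 1) = (r - k') * s + (j' - r - 1)"
      using assms(9) 1 unfolding block_def by simp
    moreover have "j - r - 1 < s" "j' - r - 1 < s" using assms(1,2,5,6) n by linarith+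
    ultimately have eq: "r - k = r - k' \<and> j - r - 1 = j' - r - 1" by (rule mult_add_inj)
    then have "k = k'" using 1 by linarith
    moreover have "j = j'" using eq assms(1,5) by linarith
    ultimately show ?thesis by simp
  next
    case 2
    have "tri_index (j - r - 1) (k - r - 1) = tri_index (j' - r - 1) (k' - r - 1)"
      using assms(9) 2 by (simp only: block_def not_le[symmetric] if_False)
    with diff_le_mono[OF diff_le_mono[OF assms(4)]] diff_le_mono[OF diff_le_mono[OF assms(8)]]
    have eq: "j - r - 1 = j' - r - 1 \<and> k - r - 1 = k' - r - 1" by (rule tri_index_inj)
    then have "k = k'" using 2 by linarith
    moreover have "j = j'" using eq assms(1,5) by linarith
    ultimately show ?thesis by simp
  next
    case 3
    then have "triangle s \<le> block j k" "block j' k' < triangle s"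
      using less[OF assms(5,6) _ assms(8)] by (simp_all add: block_def)
    with assms(9) show ?thesis by simp
  next
    case 4
    then have "triangle s \<le> block j' k'" "block j k < triangle s"
      using less[OF assms(1,2) _ assms(4)] by (simp_all add: block_def)
    with assms(9) show ?thesis by simp
  qed
qed

lemma stretch_inj:
  assumes "x < m" "x' < m" "stretch a x = stretch a' x'"
  shows "a = a' \<and> x = x'"
proof (cases "even n")
  case True
  with assms(3) have "a * m + x = a' * m + x'" by (simp add: stretch_def)
  then show ?thesis using assms(1,2) by (rule mult_add_inj)
next
  case False
  then have eq: "2 * (a div 2 * m + x) + a mod 2 = 2 * (a' div 2 * m + x') + a' mod 2"
    using assms by (simp add: stretch_def)
  then have "(a div 2 * m + x) * 2 + a mod 2 = (a' div 2 * m + x') * 2 + a' mod 2"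
    by (simp only: mult.commute)
  then have "a div 2 * m + x = a' div 2 * m + x' \<and> a mod 2 = a' mod 2"
    by (rule mult_add_inj) simp_all
  then have "a div 2 * m + x = a' div 2 * m + x'" and mod: "a mod 2 = a' mod 2" by simp_all
  from this(1) assms(1,2) have "a div 2 = a' div 2 \<and> x = x'" by (rule mult_add_inj)
  with mod div_mult_mod_eq[of a 2] div_mult_mod_eq[of a' 2] show ?thesis by linarith
qed

lemma stretch_strict_mono:
  assumes "a < a'"
  shows "stretch a x < stretch a' x"
proof (cases "even n")
  case True
  with assms m show ?thesis by (simp add: stretch_def)
next
  case odd: False
  show ?thesis
  proof (cases "a div 2 = a' div 2")
    case True
    with assms div_mult_mod_eq[of a 2] div_mult_mod_eq[of a' 2] True have "a mod 2 < a' mod 2" by linarith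
    with True odd show ?thesis by (simp add: stretch_def)
  next
    case False
    moreover have "a div 2 \<le> a' div 2" using assms by (intro div_le_mono) simp
    ultimately have "Suc (a div 2) \<le> a' div 2" by linarith
    then have "Suc (a div 2) * m \<le> a' div 2 * m" by (rule mult_le_mono1)
    then have "a div 2 * m + 3 \<le> a' div 2 * m" using m by simp
    moreover have "a mod 2 < 2" by simp
    ultimately have "2 * (a div 2 * m + x) + a mod 2 < 2 * (a' div 2 * m + x) + a' mod 2"
      unfolding add_mult_distrib2 by linarith
    with odd show ?thesis by (simp add: stretch_def)
  qed
qed

text \<open>An unpaired last row overshoots the \<open>m s\<close> labels of column 1 by at most \<open>m - 1\<close>, the number of its
  gaps.\<close>

lemma stretch_less:
  assumes "a < s" "x < m"
  shows "stretch a x < m * s + (m - 1)"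
proof (cases "even n")
  case True
  then show ?thesis using mult_add_less[OF assms] by (simp add: stretch_def mult.commute)
next
  case False
  define q where "q = a div 2"
  show ?thesis
  proof (cases "even a")
    case True
    then have "a = 2 * q" by (simp add: q_def)
    then have "(2 * q + 1) * m \<le> s * m" using assms by (intro mult_le_mono1) simp
    then have "2 * (q * m) + m \<le> m * s" by (simp add: algebra_simps)
    then show ?thesis using False True assms by (simp add: stretch_def q_def[symmetric])
  next
    case odd: False
    then have "a = 2 * q + 1" by (simp add: q_def)
    then have "(2 * q + 2) * m \<le> s * m" using assms by (intro mult_le_mono1) simp
    then have "2 * (q * m) + 2 * m \<le> m * s" by (simp add: algebra_simps)
    moreover have "stretch a x = 2 * (q * m + x) + 1"
      using False odd by (simp add: stretch_def q_def mod_2_eq_odd)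
    ultimately have "stretch a x < m * s" using \<open>x < m\<close> by simp
    then show ?thesis by simp
  qed
qed

lemma entry_le_base:
  assumes "r < j" "j \<le> n" "2 \<le> k" "k \<le> n" "x < m"
  shows "entry j k x \<le> base"
proof -
  have "block j k * m + x < base"
    unfolding base_def using assms by (intro mult_add_less block_less) auto
  then show ?thesis using assms by (simp add: entry_def)
qed

lemma entry_first_col: "base < entry j 1 x"
  by (simp add: entry_def)

lemma entry_le:
  assumes "r < j" "j \<le> n" "1 \<le> k" "k \<le> n" "x < m"
  shows "entry j k x \<le> base + (if k = 1 then m * s + (m - 1) else 0)"
proof (cases "k = 1")
  case True
  have "j - r - 1 < s" using assms n by linarith
  then have "stretch (j - r - 1) x < m * s + (m - 1)" using assms by (intro stretch_less)
  then show ?thesis using True by (simp add: entry_def)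
next
  case False
  then show ?thesis using entry_le_base[of j k x] assms by simp
qed

lemma entry_strict_mono_row:
  assumes "r < j" "j < j'"
  shows "entry j k x < entry j' k x"
proof -
  have "block j k < block j' k"
    using assms tri_index_strict_mono[of "j - r - 1" "j' - r - 1" "k - r - 1"]
    by (auto simp: block_def)
  then have "block j k * m + x < block j' k * m + x" using m by simp
  moreover have "stretch (j - r - 1) x < stretch (j' - r - 1) x"
    using assms by (intro stretch_strict_mono) auto
  ultimately show ?thesis by (simp add: entry_def)
qed

lemma entry_strict_antimono_col:
  assumes "1 \<le> c" "c < c'" "c' \<le> r" "r < j" "j \<le> n" "x < m"
  shows "entry j c' x < entry j c x"
proof (cases "c = 1")
  case True
  have "entry j c' x \<le> base" using assms n by (intro entry_le_base) auto
  then show ?thesis using True entry_first_col[of j x] by simp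
next
  case False
  have "(r - c') * s < (r - c) * s" using assms s by simp
  moreover have "block j c' = triangle s + ((r - c') * s + (j - r - 1))"
    "block j c = triangle s + ((r - c) * s + (j - r - 1))"
    using assms unfolding block_def by simp_all
  ultimately have "block j c' < block j c" by linarith
  then have "block j c' * m + x < block j c * m + x" using m by simp
  then show ?thesis using False assms by (simp add: entry_def)
qed

lemma entry_outer_col:
  assumes "r < j" "j \<le> n" "r < k" "k \<le> n" "x < m"
  shows "entry j k x \<le> triangle s * m"
proof -
  have "tri_index (j - r - 1) (k - r - 1) * m + x < triangle s * m"
    using assms n by (intro mult_add_less tri_index_less) auto
  then show ?thesis using assms r by (simp add: entry_def block_def)
qed

lemma entry_core_col:
  assumes "r < j" "1 \<le> c" "c \<le> r"
  shows "triangle s * m < entry j c x"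
proof -
  have "triangle s \<le> block j c" using assms unfolding block_def by simp
  then have "triangle s * m \<le> block j c * m" by (rule mult_le_mono1)
  then have "triangle s * m < Suc (block j c * m + x)" by linarith
  moreover have "triangle s * m < Suc (base + stretch (j - r - 1) x)"
    by (simp add: base_def add_mult_distrib)
  ultimately show ?thesis by (simp add: entry_def del: mult_le_cancel2)
qed

lemma outer_label_commute:
  assumes "r < j" "r < k"
  shows "outer_label i j k = outer_label i k j"
  using assms r
  by (simp add: outer_label_def entry_def level_def ascending_def block_def tri_index_commute add.commute)

lemma inj_on_outer_label: "inj_on (\<lambda>(i, j, k). outer_label i j k) outer_cells"
proof (rule inj_onI)
  fix p p'
  assume p: "p \<in> outer_cells" "p' \<in> outer_cells"
    "(\<lambda>(i, j, k). outer_label i j k) p = (\<lambda>(i, j, k). outer_label i j k) p'"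
  obtain i j k i' j' k' where [simp]: "p = (i, j, k)" "p' = (i', j', k')" by (metis prod_cases3)
  from p have c: "(i, j, k) \<in> outer_cells" "(i', j', k') \<in> outer_cells"
    and eq: "outer_label i j k = outer_label i' j' k'" by simp_all
  let ?x = "level i j k" and ?x' = "level i' j' k'"
  from c have ij: "1 \<le> i" "i \<le> m" "r < j" "j \<le> n" "1 \<le> k" "k \<le> j"
    "1 \<le> i'" "i' \<le> m" "r < j'" "j' \<le> n" "1 \<le> k'" "k' \<le> j'" by (auto simp: outer_cells_def)
  then have x: "?x < m" "?x' < m" by (simp_all add: level_less)
  have first: "entry j k x \<le> base \<longleftrightarrow> k \<noteq> 1" if "r < j" "j \<le> n" "1 \<le> k" "k \<le> j" "x < m" for j k x
    using entry_le_base[of j k x] entry_first_col[of j x] that by fastforce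
  have k: "k = 1 \<longleftrightarrow> k' = 1"
    using first[of j k ?x] first[of j' k' ?x'] eq ij x by (simp add: outer_label_def)
  have "j = j' \<and> k = k' \<and> ?x = ?x'"
  proof (cases "k = 1")
    case True
    then show ?thesis using eq k x ij stretch_inj[of ?x ?x' "j - r - 1" "j' - r - 1"]
      by (auto simp: outer_label_def entry_def)
  next
    case False
    then have "block j k * m + ?x = block j' k' * m + ?x'"
      using eq k by (simp add: outer_label_def entry_def)
    then have "block j k = block j' k' \<and> ?x = ?x'" using x by (rule mult_add_inj)
    then show ?thesis using block_inj[of j k j' k'] ij False k by auto
  qed
  then have "j = j'" "k = k'" "level i j k = level i' j k" by auto
  then show "p = p'"
    using ij inj_onD[OF bij_betw_imp_inj_on[OF bij_betw_level[of j k]], of i i'] by auto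
qed

text \<open>An injection into an interval of the same size is onto; hence no label up to \<open>base\<close> is left for the
  core.\<close>

lemma inner_labels: "(\<lambda>(i, j, k). outer_label i j k) ` inner_cells = {1..base}"
proof (rule card_subset_eq)
  show "(\<lambda>(i, j, k). outer_label i j k) ` inner_cells \<subseteq> {1..base}"
  proof clarify
    fix i j k assume "(i, j, k) \<in> inner_cells"
    then have "outer_label i j k \<le> base"
      unfolding outer_label_def inner_cells_def by (intro entry_le_base level_less) auto
    then show "outer_label i j k \<in> {1..base}" by (simp add: outer_label_def entry_def)
  qed
  have "inner_cells \<subseteq> outer_cells" by (auto simp: inner_cells_def outer_cells_def)
  then show "card ((\<lambda>(i, j, k). outer_label i j k) ` inner_cells) = card {1..base}"
    using inj_on_subset[OF inj_on_outer_label] by (simp add: card_image card_inner_cells)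
qed simp

text \<open>Column 1 stays within the available labels because the core block supplies at least the \<open>m - 1\<close>
  labels by which it may overshoot.\<close>

lemma outer_labels_subset:
  "(\<lambda>(i, j, k). outer_label i j k) ` outer_cells \<subseteq> {1..base + m * s + triangle r}"
proof clarify
  fix i j k assume "(i, j, k) \<in> outer_cells"
  then have "outer_label i j k \<le> base + (if k = 1 then m * s + (m - 1) else 0)"
    unfolding outer_label_def outer_cells_def by (intro entry_le level_less) auto
  then have "outer_label i j k \<le> base + m * s + triangle r" using m_le by (auto split: if_splits)
  then show "outer_label i j k \<in> {1..base + m * s + triangle r}" by (simp add: outer_label_def entry_def)
qed

definition core_labels :: "nat set" where
  "core_labels = {1..base + m * s + triangle r} - (\<lambda>(i, j, k). outer_label i j k) ` outer_cells"

lemma card_core_labels: "card core_labels = triangle r"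
  using outer_labels_subset finite_cells
  by (simp add: core_labels_def card_Diff_subset card_image inj_on_outer_label card_outer_cells)

lemma core_labels_gt_base:
  assumes "y \<in> core_labels"
  shows "base < y"
proof (rule ccontr)
  assume "\<not> base < y"
  with assms have "y \<in> {1..base}" by (auto simp: core_labels_def)
  also have "\<dots> \<subseteq> (\<lambda>(i, j, k). outer_label i j k) ` outer_cells"
    unfolding inner_labels[symmetric] by (intro image_mono) (auto simp: inner_cells_def outer_cells_def)
  finally show False using assms by (simp add: core_labels_def)
qed

section \<open>Constant row sums\<close>

definition sign :: "nat \<Rightarrow> nat \<Rightarrow> int" where
  "sign j k = (if ascending j k then 1 else - 1)"

definition step :: "nat \<Rightarrow> int" where
  "step k = (if odd n \<and> k = 1 then 2 else 1)"

lemma sum_alternating: "(\<Sum>k=1..N. (- 1) ^ k) = (if odd N then - 1 else 0 :: int)"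
  by (induction N) auto

text \<open>Reversing columns 1 and 2 and doubling the step in column 1 turns the entries \<open>-1, 1\<close> of the
  alternating pattern into \<open>2, -1\<close>, a change by \<open>3\<close> and \<open>-2\<close>. The total change \<open>1\<close> compensates the
  alternating sum \<open>-1\<close> of odd length.\<close>

lemma sum_step_sign: "(\<Sum>k=1..n. step k * sign j k) = 0"
proof -
  \<comment> \<open>the deviation from the alternating pattern, up to the common sign of the row\<close>
  define corr :: "nat \<Rightarrow> int" where
    "corr k = (if odd n then (if k = 1 then 3 else 0) + (if k = 2 then - 2 else 0) else 0)" for k
  have "step k * sign j k = (- 1) ^ j * ((- 1) ^ k + corr k)" if "1 \<le> k" for k
  proof -
    have "k = 1 \<or> k = 2 \<or> k > 2" using that by linarith
    then show ?thesis
      by (elim disjE) (auto simp: step_def sign_def ascending_def corr_def minus_one_power_iff)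
  qed
  then have "(\<Sum>k=1..n. step k * sign j k) = (\<Sum>k=1..n. (- 1) ^ j * ((- 1) ^ k + corr k))"
    by (intro sum.cong) auto
  also have "\<dots> = (- 1) ^ j * ((\<Sum>k=1..n. (- 1) ^ k) + (\<Sum>k=1..n. corr k))"
    by (simp only: sum.distrib sum_distrib_left distrib_left)
  also have "(\<Sum>k=1..n. corr k) = (if odd n then 1 else 0)"
  proof (cases "odd n")
    case True
    have "1 \<in> {1..n}" "2 \<in> {1..n}" using r n by simp_all
    with True show ?thesis by (simp add: corr_def sum.distrib)
  qed (simp add: corr_def)
  finally show ?thesis unfolding sum_alternating by simp
qed

text \<open>Centring the copy index at \<open>(m + 1) / 2\<close> separates the direction from the constant part; the factor 2
  keeps everything integral.\<close>

lemma double_outer_label: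
  assumes "1 \<le> i" "i \<le> m"
  shows "2 * int (outer_label i j k) =
    2 * int (entry j k 0) + step k * (int m - 1) + step k * sign j k * (2 * int i - int m - 1)"
proof -
  have entry: "int (entry j k x) = int (entry j k 0) + step k * int x" for x
    by (auto simp: entry_def stretch_def step_def)
  have level: "2 * int (level i j k) = (int m - 1) + sign j k * (2 * int i - int m - 1)"
    using assms by (auto simp: level_def sign_def)
  have "2 * int (outer_label i j k) = 2 * int (entry j k 0) + step k * (2 * int (level i j k))"
    unfolding outer_label_def by (subst entry) simp
  then show ?thesis by (simp only: level distrib_left mult.assoc add.assoc)
qed

lemma outer_row_sum:
  assumes "1 \<le> i" "i \<le> m"
  shows "(\<Sum>k=1..n. outer_label i j k) = (\<Sum>k=1..n. outer_label 1 j k)"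
proof -
  have *: "2 * int (\<Sum>k=1..n. outer_label i j k) = (\<Sum>k=1..n. 2 * int (entry j k 0) + step k * (int m - 1))"
    if "1 \<le> i" "i \<le> m" for i
  proof -
    have "2 * int (\<Sum>k=1..n. outer_label i j k) = (\<Sum>k=1..n. 2 * int (outer_label i j k))"
      by (simp add: sum_distrib_left)
    also have "\<dots> = (\<Sum>k=1..n. 2 * int (entry j k 0) + step k * (int m - 1))
        + (\<Sum>k=1..n. step k * sign j k) * (2 * int i - int m - 1)"
      by (simp only: double_outer_label[OF that] sum.distrib sum_distrib_right)
    finally show ?thesis unfolding sum_step_sign by simp
  qed
  have "1 \<le> m" using m by simp
  then have "2 * int (\<Sum>k=1..n. outer_label i j k) = 2 * int (\<Sum>k=1..n. outer_label 1 j k)"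
    by (intro trans[OF *[OF assms] *[OF le_refl, symmetric]])
  then show ?thesis by linarith
qed

section \<open>Distinct weights\<close>

text \<open>Every progression is used once by each copy, so summing over the copies removes the directions.\<close>

lemma sum_copies: "(\<Sum>i=1..m. outer_label i j k) = (\<Sum>x<m. entry j k x)"
  unfolding outer_label_def by (rule sum.reindex_bij_betw[OF bij_betw_level])

text \<open>Within a single copy the directions can spoil an entrywise comparison of two rows. As the row sum
  is the same in all copies, it may be multiplied by \<open>m\<close> and compared summed over all
  copies, where entries are ordered position by position.\<close>

lemma outer_row_strict_mono:
  assumes "r < j" "j < j'"
  shows "(\<Sum>k=1..n. outer_label 1 j k) < (\<Sum>k=1..n. outer_label 1 j' k)"
proof -
  have *: "m * (\<Sum>k=1..n. outer_label 1 j k) = (\<Sum>k=1..n. \<Sum>x<m. entry j k x)" for j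
  proof -
    have "m * (\<Sum>k=1..n. outer_label 1 j k) = (\<Sum>i=1..m. \<Sum>k=1..n. outer_label 1 j k)"
      by simp
    also have "\<dots> = (\<Sum>i=1..m. \<Sum>k=1..n. outer_label i j k)"
      by (intro sum.cong refl outer_row_sum[symmetric]) auto
    also have "\<dots> = (\<Sum>k=1..n. \<Sum>i=1..m. outer_label i j k)" by (rule sum.swap)
    finally show ?thesis by (simp only: sum_copies)
  qed
  have "(\<Sum>k=1..n. \<Sum>x<m. entry j k x) < (\<Sum>k=1..n. \<Sum>x<m. entry j' k x)"
    using m n r assms by (intro sum_strict_mono entry_strict_mono_row) (auto simp: lessThan_empty_iff)
  then show ?thesis unfolding *[symmetric] by simp
qed

text \<open>The core block receives the remaining labels in decreasing order, because in the core columns labels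
  already decrease with the column index.\<close>

lemma chi_lat_amalg: "chi_lat (amalg_verts m n r) (amalg_edges m n r) = n"
proof -
  have "finite core_labels" by (simp add: core_labels_def)
  then obtain g where g: "bij_betw g {..<triangle r} core_labels"
    and g_anti: "\<And>x y. x < y \<Longrightarrow> y < triangle r \<Longrightarrow> g y < g x"
    using ex_decreasing_bij_betw[of core_labels] unfolding card_core_labels by metis
  define core_label where "core_label j k = g (tri_index (j - 1) (k - 1))" for j k
  define lab where "lab i j k = (if max j k \<le> r then core_label j k
    else outer_label i (max j k) (min j k))" for i j k
  define W where "W j = (if j \<le> r
    then (\<Sum>k=1..r. core_label j k) + (\<Sum>k\<in>{r<..n}. \<Sum>i=1..m. outer_label i k j)
    else (\<Sum>k=1..n. outer_label 1 j k))" for j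
  let ?lab = "\<lambda>(i, j, k). lab i j k" and ?core = "{(i, j, k) \<in> cells m n r. j \<le> r}"
  have sym: "lab i j k = lab i k j" for i j k
    by (simp add: lab_def core_label_def tri_index_commute max.commute min.commute)
  have lab_core: "lab i j k = core_label j k" if "j \<le> r" "k \<le> r" for i j k
    using that by (simp add: lab_def)
  have lab_outer: "lab i j k = outer_label i j k" if "r < j" for i j k
    using that by (auto simp: lab_def max_def min_def intro: outer_label_commute)
  have cells: "cells m n r = ?core \<union> outer_cells" and disj: "?core \<inter> outer_cells = {}"
    using m by (auto simp: cells_def outer_cells_def)
  have bij_core_cells: "bij_betw (\<lambda>(i, j, k). (j - 1, k - 1)) ?core {(a, b). b \<le> a \<and> a < r}"
    using m n by (intro bij_betw_byWitness[where f' = "\<lambda>(a, b). (1, Suc a, Suc b)"]) (auto simp: cells_def)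
  have card: "card (cells m n r) = base + m * s + triangle r"
  proof -
    have "finite {(a, b). b \<le> a \<and> a < r}"
      by (rule finite_subset[of _ "{..<r} \<times> {..<r}"]) auto
    then have "finite ?core" using bij_betw_finite[OF bij_core_cells] by simp
    moreover have "card ?core = triangle r"
      using bij_betw_same_card[OF bij_core_cells] by (simp add: card_below_diagonal)
    ultimately show ?thesis
      by (subst cells) (simp add: card_Un_disjoint finite_cells disj card_outer_cells)
  qed
  have bij_core: "bij_betw ?lab ?core core_labels"
  proof -
    have "bij_betw (g \<circ> ((\<lambda>(a, b). tri_index a b) \<circ> (\<lambda>(i, j, k). (j - 1, k - 1)))) ?core core_labels"
      by (intro bij_betw_trans[OF _ g] bij_betw_trans[OF bij_core_cells] bij_betw_tri_index)
    then show ?thesis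
      by (rule bij_betw_cong[THEN iffD1, rotated]) (auto simp: cells_def lab_def core_label_def)
  qed
  have bij_outer: "bij_betw ?lab outer_cells ((\<lambda>(i, j, k). outer_label i j k) ` outer_cells)"
  proof -
    have "bij_betw (\<lambda>(i, j, k). outer_label i j k) outer_cells ((\<lambda>(i, j, k). outer_label i j k) ` outer_cells)"
      using inj_on_outer_label by (rule inj_on_imp_bij_betw)
    then show ?thesis
      by (rule bij_betw_cong[THEN iffD1, rotated]) (auto simp: outer_cells_def lab_outer)
  qed
  have bij: "bij_betw ?lab (cells m n r) {1..card (cells m n r)}"
  proof -
    have "bij_betw ?lab (?core \<union> outer_cells) (core_labels \<union> (\<lambda>(i, j, k). outer_label i j k) ` outer_cells)"
      using bij_core bij_outer by (rule bij_betw_combine) (unfold core_labels_def, blast)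
    also have "core_labels \<union> (\<lambda>(i, j, k). outer_label i j k) ` outer_cells = {1..card (cells m n r)}"
      unfolding core_labels_def card Un_Diff_cancel2 using outer_labels_subset by (rule Un_absorb2)
    finally show ?thesis using cells by simp
  qed
  have split_cols: "(\<Sum>k=1..n. h k) = (\<Sum>k=1..r. h k) + (\<Sum>k\<in>{r<..n}. h k)" for h :: "nat \<Rightarrow> nat"
  proof -
    have "{1..n} = {1..r} \<union> {r<..n}" using n by auto
    then show ?thesis by (simp only:) (rule sum.union_disjoint, auto)
  qed
  have core_label_mem: "core_label c k \<in> core_labels" if "1 \<le> c" "c \<le> r" "1 \<le> k" "k \<le> r" for c k
    unfolding core_label_def using that
    by (intro bij_betwE[OF g, rule_format]) (auto intro: tri_index_less)
  have W_outer: "W j < W j'" if "r < j" "j < j'" for j j'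
    using that outer_row_strict_mono by (simp add: W_def)
  have W_core: "W c' < W c" if "1 \<le> c" "c < c'" "c' \<le> r" for c c'
  proof -
    have "core_label c' k \<le> core_label c k" if "k \<in> {1..r}" for k
      unfolding core_label_def using that \<open>1 \<le> c\<close> \<open>c < c'\<close> \<open>c' \<le> r\<close>
      by (intro less_imp_le[OF g_anti] tri_index_strict_mono tri_index_less) auto
    then have "(\<Sum>k=1..r. core_label c' k) \<le> (\<Sum>k=1..r. core_label c k)" by (rule sum_mono)
    moreover have "(\<Sum>k\<in>{r<..n}. \<Sum>x<m. entry k c' x) < (\<Sum>k\<in>{r<..n}. \<Sum>x<m. entry k c x)"
      using m n s that by (intro sum_strict_mono entry_strict_antimono_col) (auto simp: lessThan_empty_iff)
    ultimately show ?thesis using that unfolding W_def sum_copies by simp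
  qed
  have W_core_outer: "W j < W c" if "1 \<le> c" "c \<le> r" "r < j" "j \<le> n" for c j
  proof -
    let ?T = "triangle s"
    \<comment> \<open>In the core columns the core label can only lose in column 1, by less than \<open>m * s + m\<close>. In the outer
      columns all \<open>m\<close> copies count for the core vertex, each beating the label of the outer one, and
      \<open>m \<ge> 3\<close> makes this surplus exceed the loss.\<close>
    have "outer_label 1 j k \<le> core_label c k + (if k = 1 then m * s + m else 0)" if "k \<in> {1..r}" for k
    proof -
      have "outer_label 1 j k \<le> base + (if k = 1 then m * s + (m - 1) else 0)"
        unfolding outer_label_def using that \<open>r < j\<close> \<open>j \<le> n\<close> m n by (intro entry_le level_less) auto
      moreover have "base < core_label c k"
        using that \<open>1 \<le> c\<close> \<open>c \<le> r\<close> by (intro core_labels_gt_base core_label_mem) auto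
      ultimately show ?thesis by (auto split: if_splits)
    qed
    then have "(\<Sum>k=1..r. outer_label 1 j k) \<le> (\<Sum>k=1..r. core_label c k + (if k = 1 then m * s + m else 0))"
      by (rule sum_mono)
    also have "\<dots> = (\<Sum>k=1..r. core_label c k) + (m * s + m)"
      using r by (simp add: sum.distrib)
    finally have 1: "(\<Sum>k=1..r. outer_label 1 j k) \<le> (\<Sum>k=1..r. core_label c k) + (m * s + m)" .
    have "(\<Sum>k\<in>{r<..n}. outer_label 1 j k) \<le> (\<Sum>k\<in>{r<..n}. ?T * m)"
      unfolding outer_label_def using that m by (intro sum_mono entry_outer_col level_less) auto
    then have 2: "(\<Sum>k\<in>{r<..n}. outer_label 1 j k) \<le> s * (?T * m)" by (simp add: n)
    have "(\<Sum>k\<in>{r<..n}. \<Sum>i=1..m. Suc (?T * m)) \<le> (\<Sum>k\<in>{r<..n}. \<Sum>i=1..m. outer_label i k c)"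
      unfolding outer_label_def using that by (intro sum_mono Suc_leI entry_core_col) auto
    then have 3: "s * (m * Suc (?T * m)) \<le> (\<Sum>k\<in>{r<..n}. \<Sum>i=1..m. outer_label i k c)" by (simp add: n)
    define X where "X = s * (?T * m)"
    have "1 \<le> ?T" using triangle_mono[OF s] by simp
    then have "1 * (1 * m) \<le> X" unfolding X_def using s by (intro mult_le_mono) auto
    moreover have "3 * X \<le> m * X" using m by simp
    ultimately have "m + X < m * X" using m by linarith
    moreover have "s * (m * Suc (?T * m)) = m * X + m * s" by (simp add: X_def algebra_simps)
    ultimately have "m * s + m + s * (?T * m) < s * (m * Suc (?T * m))"
      unfolding X_def[symmetric] by linarith
    with 1 2 3 show ?thesis using that unfolding W_def split_cols by simp
  qed
  have W_neq: "W j \<noteq> W j'" if "1 \<le> j" "j < j'" "j' \<le> n" for j j'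
    using that W_core[of j j'] W_outer[of j j'] W_core_outer[of j j'] by (cases "j' \<le> r"; cases "j \<le> r") auto
  have "inj_on W {1..n}"
  proof (rule inj_onI)
    fix j k assume "j \<in> {1..n}" "k \<in> {1..n}" "W j = W k"
    then show "j = k" using W_neq[of j k] W_neq[of k j] by (cases j k rule: linorder_cases) auto
  qed
  then show ?thesis
  proof (rule chi_lat_amalg_eqI[rotated -1])
    show "(\<Sum>k=1..r. lab i j k) + (\<Sum>k\<in>{r<..n}. lab i j k) = W j"
      if "1 \<le> i" "i \<le> m" "r < j" "j \<le> n" for i j
      using outer_row_sum[OF that(1,2), of j] that(3)
      unfolding split_cols[symmetric] lab_outer[OF that(3)] W_def by simp
    show "(\<Sum>k=1..r. lab 1 c k) + (\<Sum>k\<in>{r<..n}. \<Sum>i=1..m. lab i k c) = W c"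
      if "1 \<le> c" "c \<le> r" for c
    proof -
      have "(\<Sum>k=1..r. lab 1 c k) = (\<Sum>k=1..r. core_label c k)"
        using that by (intro sum.cong refl lab_core) auto
      moreover have "(\<Sum>k\<in>{r<..n}. \<Sum>i=1..m. lab i k c) = (\<Sum>k\<in>{r<..n}. \<Sum>i=1..m. outer_label i k c)"
        by (intro sum.cong refl lab_outer) auto
      ultimately show ?thesis using that(2) unfolding W_def by simp
    qed
  qed (use m n sym bij in auto)
qed

end

theorem theorem3p1:
  fixes m n r :: nat
  assumes "3 \<le> m" and "r + 1 \<le> n" and "3 \<le> r + 1"
    and "(3 \<le> m \<and> m \<le> 4 \<and> 2 \<le> r \<and> r \<le> 3) \<or> (m - 1) * (r - 1) < (r + 1) choose 2"
  shows "chi_lat (amalg_verts m n r) (amalg_edges m n r) = n"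
proof -
  have tri: "(r + 1) choose 2 = triangle r" by (simp add: choose_two triangle_def mult.commute)
  have "m - 1 \<le> triangle r"
    using assms(4)
  proof
    assume "3 \<le> m \<and> m \<le> 4 \<and> 2 \<le> r \<and> r \<le> 3"
    moreover have "triangle 2 \<le> triangle r" using assms(3) by (intro triangle_mono) simp
    moreover have "triangle 2 = 3" by (simp add: triangle_def)
    ultimately show ?thesis by linarith
  next
    assume less: "(m - 1) * (r - 1) < (r + 1) choose 2"
    have "(m - 1) * 1 \<le> (m - 1) * (r - 1)" using assms(3) by (intro mult_le_mono2) simp
    with less show ?thesis unfolding tri by linarith
  qed
  then interpret amalg_labeling m n r "n - r"
    using assms by unfold_locales auto
  show ?thesis by (rule chi_lat_amalg)
qed

end
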